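(* Let $n\ge 2$, let $G=[g_{ij}]$ be an interaction network on $N=\{1,\dots,n\}$, let $\tau_x,\tau_y>0$, and let $\gamma=\tau_x/(\tau_x+\tau_y)$. Then $\Delta W(\tau_x,\tau_y,G)<0$ if and only if $$\sum_{i\in N}c_i(\gamma,G)\Big((1-d_i^{in})\,c_i(\gamma,G)+2d_i^{in}\Big)<0,$$ where $d_i^{in}=\sum_{j\ne i}g_{ji}$ is agent $i$'s in-degree.
   Context: Interaction network: an $n\times n$ real matrix $G=[g_{ij}]$ with $g_{ij}\ge 0$, $g_{ii}=0$, and $d_i^{out}:=\sum_{j\ne i}g_{ij}<1$ for all $i\in N$. Payoffs: agent $i$ chooses $a_i\in\mathbb{R}$; with $a=(a_j)_{j\in N}$ and common state $\theta\in\mathbb{R}$, $$u_i(a,\theta)=-\Big(1-\sum_{j\neq i}g_{ij}\Big)(a_i-\theta)^2-\sum_{j\ne i}g_{ij}(a_i-a_j)^2 .$$ Information: $\theta$ has the improper uniform prior on $\mathbb{R}$. Agent $i$ observes a private signal $x_i=\theta+\varepsilon_i$ and a public signal $y=\theta+\varepsilon_y$, where $\varepsilon_i\sim N(0,\tau_x^{-1})$, $\varepsilon_y\sim N(0,\tau_y^{-1})$, and $\theta,\varepsilon_1,\dots,\varepsilon_n,\varepsilon_y$ are jointly independent. $\gamma=\tau_x/(\tau_x+\tau_y)\in(0,1)$. Katz-Bonacich centrality vector: $\mathbf{c}(\gamma,G)=(c_1(\gamma,G),\dots,c_n(\gamma,G))'=(I-\gamma G)^{-1}\mathbf{1}$,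 where $\mathbf{1}$ is the all-ones vector. Equilibrium: the game has a unique linear Bayesian Nash equilibrium, $a_i^*=(1-\gamma)c_i(\gamma,G)\,y+\big(1-(1-\gamma)c_i(\gamma,G)\big)x_i$ for $i\in N$. Aggregate welfare: $W(\tau_x,\tau_y,G)=\sum_{i\in N}\mathbb{E}[u_i(a^*,\theta)]$, where the expectation is over the noise terms (the payoffs $u_i(a^*,\theta)$ depend only on the noise terms, not on $\theta$). $W(\tau_x,0,G)=-\sum_{i\in N}\tau_x^{-1}(1+d_i^{out})$ denotes aggregate equilibrium welfare in the absence of the public signal (where $a_i=x_i$ for all $i$). The welfare effect of public information provision is $\Delta W(\tau_x,\tau_y,G)=W(\tau_x,\tau_y,G)-W(\tau_x,0,G)$. *)

theory Defs
  imports "HOL-Probability.Probability"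
begin

text \<open>Agents are the elements of a finite type \<open>'n\<close>; \<open>G $ i $ j\<close> is the weight
  that agent \<open>i\<close> puts on agent \<open>j\<close>.\<close>

definition out_degree :: "real ^ 'n ^ 'n \<Rightarrow> 'n::finite \<Rightarrow> real" where
  "out_degree G i = (\<Sum>j\<in>UNIV - {i}. G $ i $ j)"

definition in_degree :: "real ^ 'n ^ 'n \<Rightarrow> 'n::finite \<Rightarrow> real" where
  "in_degree G i = (\<Sum>j\<in>UNIV - {i}. G $ j $ i)"

definition interaction_network :: "real ^ 'n ^ 'n::finite \<Rightarrow> bool" where
  "interaction_network G \<longleftrightarrow>
     (\<forall>i j. 0 \<le> G $ i $ j) \<and> (\<forall>i. G $ i $ i = 0) \<and> (\<forall>i. out_degree G i < 1)"

definition katz_bonacich :: "real \<Rightarrow> real ^ 'n ^ 'n \<Rightarrow> real ^ 'n::finite" where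
  "katz_bonacich \<gamma> G = matrix_inv (mat 1 - \<gamma> *\<^sub>R G) *v (\<chi> i. 1)"

definition payoff :: "real ^ 'n ^ 'n \<Rightarrow> 'n::finite \<Rightarrow> ('n \<Rightarrow> real) \<Rightarrow> real \<Rightarrow> real" where
  "payoff G i a \<theta> =
     - (1 - (\<Sum>j\<in>UNIV - {i}. G $ i $ j)) * (a i - \<theta>)\<^sup>2
     - (\<Sum>j\<in>UNIV - {i}. G $ i $ j * (a i - a j)\<^sup>2)"


text \<open>A signal of precision \<open>\<tau>\<close> has standard deviation \<open>1 / sqrt \<tau>\<close>. Joint independence of
  the noise terms is expressed by taking product measures.\<close>

definition noise :: "real \<Rightarrow> real measure" where
  "noise \<tau> = density lborel (\<lambda>e. ennreal (normal_density 0 (1 / sqrt \<tau>) e))"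

definition private_noise :: "real \<Rightarrow> ('n::finite \<Rightarrow> real) measure" where
  "private_noise \<tau>x = (\<Pi>\<^sub>M i\<in>UNIV. noise \<tau>x)"

definition likelihood :: "real \<Rightarrow> real \<Rightarrow> real \<Rightarrow> real" where
  "likelihood \<tau> z \<theta> = normal_density \<theta> (1 / sqrt \<tau>) z"


text \<open>Interim expected payoff of agent \<open>i\<close> from action \<open>b\<close> when every other agent \<open>j\<close> plays
  \<open>s j\<close> as a function of its private signal. The improper uniform prior enters through Bayes'
  rule: the posterior density of \<open>\<theta>\<close> is the likelihood \<open>L\<close> of the signals observed by \<open>i\<close>,
  normalised to integrate to 1. Given \<open>\<theta>\<close>, these signals carry no information on the noise
  of the others.\<close>

definition interim_payoff ::
  "real ^ 'n ^ 'n \<Rightarrow> real \<Rightarrow> 'n::finite \<Rightarrow> (real \<Rightarrow> real) \<Rightarrow> ('n \<Rightarrow> real \<Rightarrow> real) \<Rightarrow> real \<Rightarrow> real"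
where
  "interim_payoff G \<tau>x i L s b =
     (\<integral>\<theta>. L \<theta> * (\<integral>\<epsilon>. payoff G i ((\<lambda>j. s j (\<theta> + \<epsilon> j))(i := b)) \<theta> \<partial>private_noise \<tau>x) \<partial>lborel)
     / (\<integral>\<theta>. L \<theta> \<partial>lborel)"


text \<open>The game with public signal: \<open>s i x y\<close> is the action of agent \<open>i\<close> at private signal \<open>x\<close>
  and public signal \<open>y\<close>. Linear strategies are allowed an intercept; the intercept is zero in
  equilibrium.\<close>

definition linear_BNE ::
  "real ^ 'n ^ 'n \<Rightarrow> real \<Rightarrow> real \<Rightarrow> ('n::finite \<Rightarrow> real \<Rightarrow> real \<Rightarrow> real) \<Rightarrow> bool"
where
  "linear_BNE G \<tau>x \<tau>y s \<longleftrightarrow>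
     (\<forall>i. \<exists>\<alpha> \<beta> \<kappa>. \<forall>x y. s i x y = \<alpha> * x + \<beta> * y + \<kappa>) \<and>
     (\<forall>i x y b.
        let U = interim_payoff G \<tau>x i (\<lambda>\<theta>. likelihood \<tau>x x \<theta> * likelihood \<tau>y y \<theta>) (\<lambda>j x'. s j x' y)
        in U b \<le> U (s i x y))"

definition equilibrium ::
  "real ^ 'n ^ 'n \<Rightarrow> real \<Rightarrow> real \<Rightarrow> 'n::finite \<Rightarrow> real \<Rightarrow> real \<Rightarrow> real"
where
  "equilibrium G \<tau>x \<tau>y = (THE s. linear_BNE G \<tau>x \<tau>y s)"

text \<open>Welfare at a realised state \<open>\<theta>\<close>: the expectation is over the noise terms only, the prior
  on \<open>\<theta>\<close> being improper.\<close>

definition welfare :: "real \<Rightarrow> real \<Rightarrow> real \<Rightarrow> real ^ 'n ^ 'n::finite \<Rightarrow> real" where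
  "welfare \<theta> \<tau>x \<tau>y G =
     (\<Sum>i\<in>UNIV. \<integral>(\<epsilon>, \<epsilon>y).
        payoff G i (\<lambda>j. equilibrium G \<tau>x \<tau>y j (\<theta> + \<epsilon> j) (\<theta> + \<epsilon>y)) \<theta>
        \<partial>(private_noise \<tau>x \<Otimes>\<^sub>M noise \<tau>y))"


text \<open>The game without public signal, the case of public precision zero. Its unique linear
  equilibrium is \<open>s i x = x\<close>, with welfare \<open>- (\<Sum>i\<in>UNIV. (1 + out_degree G i) / \<tau>x)\<close>.\<close>

definition linear_BNE_private ::
  "real ^ 'n ^ 'n \<Rightarrow> real \<Rightarrow> ('n::finite \<Rightarrow> real \<Rightarrow> real) \<Rightarrow> bool"
where
  "linear_BNE_private G \<tau>x s \<longleftrightarrow>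
     (\<forall>i. \<exists>\<alpha> \<kappa>. \<forall>x. s i x = \<alpha> * x + \<kappa>) \<and>
     (\<forall>i x b. let U = interim_payoff G \<tau>x i (likelihood \<tau>x x) s in U b \<le> U (s i x))"

definition equilibrium_private :: "real ^ 'n ^ 'n \<Rightarrow> real \<Rightarrow> 'n::finite \<Rightarrow> real \<Rightarrow> real" where
  "equilibrium_private G \<tau>x = (THE s. linear_BNE_private G \<tau>x s)"

definition welfare_private :: "real \<Rightarrow> real \<Rightarrow> real ^ 'n ^ 'n::finite \<Rightarrow> real" where
  "welfare_private \<theta> \<tau>x G =
     (\<Sum>i\<in>UNIV. \<integral>\<epsilon>. payoff G i (\<lambda>j. equilibrium_private G \<tau>x j (\<theta> + \<epsilon> j)) \<theta> \<partial>private_noise \<tau>x)"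

definition welfare_effect :: "real \<Rightarrow> real \<Rightarrow> real \<Rightarrow> real ^ 'n ^ 'n::finite \<Rightarrow> real" where
  "welfare_effect \<theta> \<tau>x \<tau>y G = welfare \<theta> \<tau>x \<tau>y G - welfare_private \<theta> \<tau>x G"

end

theory Submission
  imports Defs
begin

text \<open>Against affine strategies the interim payoff of \<open>i\<close> is \<open>K - (b - t)\<^sup>2\<close>, where \<open>t\<close> is the
  complete-information best reply at the posterior mean \<open>m\<close> of the state. A linear equilibrium is
  therefore a fixed point of a linear system whose matrix \<open>I - \<gamma> G\<close> is strictly diagonally
  dominant, and \<open>(1 - \<gamma>) c\<close> are the weights on \<open>y\<close> in its solution. Welfare is then a quadratic
  form in \<open>c\<close>. The relation \<open>\<gamma> G c = c - 1\<close> removes its mixed terms, after which the welfare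
  effect is \<open>\<tau>y / (\<tau>x * (\<tau>x + \<tau>y))\<close> times the sum in the criterion.\<close>

section \<open>Moments of the noise terms\<close>

text \<open>Payoffs are quadratic, so mean zero and variance \<open>v\<close> are all that is ever
  needed of a random term. Normality matters only for the posterior of the state.\<close>

definition centred :: "'a measure \<Rightarrow> ('a \<Rightarrow> real) \<Rightarrow> real \<Rightarrow> bool" where
  "centred M X v \<longleftrightarrow> prob_space M \<and> has_bochner_integral M X 0
     \<and> has_bochner_integral M (\<lambda>\<omega>. (X \<omega>)\<^sup>2) v"

lemma has_bochner_integral_const:
  fixes c :: real
  assumes "prob_space M"
  shows "has_bochner_integral M (\<lambda>_. c) c"
  using assms by (simp add: has_bochner_integral_iff prob_space.prob_space
      finite_measure.integrable_const prob_space.finite_measure)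

lemma centred_affine:
  assumes "centred M X v"
  shows "has_bochner_integral M (\<lambda>\<omega>. (p + q * X \<omega>)\<^sup>2) (p\<^sup>2 + q\<^sup>2 * v)"
proof -
  have "has_bochner_integral M (\<lambda>\<omega>. p\<^sup>2 + 2 * p * q * X \<omega> + q\<^sup>2 * (X \<omega>)\<^sup>2)
          (p\<^sup>2 + 2 * p * q * 0 + q\<^sup>2 * v)"
    using assms unfolding centred_def
    by (intro has_bochner_integral_add has_bochner_integral_mult_right has_bochner_integral_const) auto
  then show ?thesis
    by (simp add: power2_sum power_mult_distrib algebra_simps)
qed

lemma centred_normal:
  assumes "0 < \<sigma>"
  shows "centred (density lborel (normal_density m \<sigma>)) (\<lambda>x. x - m) (\<sigma>\<^sup>2)"
proof -
  have "has_bochner_integral lborel (\<lambda>x. normal_density m \<sigma> x *\<^sub>R (x - m)) 0"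
    using normal_moment_odd[OF assms, of m 0] by simp
  moreover have "has_bochner_integral lborel (\<lambda>x. normal_density m \<sigma> x *\<^sub>R (x - m)\<^sup>2) (\<sigma>\<^sup>2)"
    using normal_moment_even[OF assms, of m 1] by simp
  ultimately show ?thesis
    unfolding centred_def using prob_space_normal_density[OF assms, of m]
    by (auto intro!: has_bochner_integral_density)
qed

lemma centred_noise:
  assumes "0 < \<tau>"
  shows "centred (noise \<tau>) (\<lambda>e. e) (1 / \<tau>)"
  using centred_normal[of "1 / sqrt \<tau>" 0] assms by (simp add: noise_def power_divide)

lemma centred_PiM_component:
  fixes N :: "real measure"
  assumes "centred N (\<lambda>e. e) v"
  shows "centred (\<Pi>\<^sub>M i\<in>(UNIV :: 'n::finite set). N) (\<lambda>\<epsilon>. \<epsilon> i) v"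
proof -
  interpret N: prob_space N using assms by (simp add: centred_def)
  interpret product_sigma_finite "\<lambda>_ :: 'n. N" by standard
  have "has_bochner_integral (\<Pi>\<^sub>M i\<in>(UNIV :: 'n set). N) (\<lambda>\<epsilon>. f (\<epsilon> i)) c"
    if "has_bochner_integral N f c" for f :: "real \<Rightarrow> real" and c
  proof -
    \<comment> \<open>Padding with the constant 1 turns a function of one coordinate into a product
      over all coordinates, to which the product rule for integrals applies.\<close>
    let ?f = "\<lambda>k. if k = i then f else (\<lambda>_. 1)"
    have int: "integrable N (?f k)" for k
      using that by (simp add: has_bochner_integral_iff)
    have "(\<Prod>k\<in>UNIV. ?f k (\<epsilon> k)) = f (\<epsilon> i)" for \<epsilon>
      by (subst prod.remove[of _ i]) auto
    moreover have "(\<Prod>k\<in>UNIV. integral\<^sup>L N (?f k)) = c"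
      using that by (subst prod.remove[of _ i]) (auto simp: has_bochner_integral_iff N.prob_space)
    ultimately show ?thesis
      using product_integrable_prod[of UNIV ?f, OF _ int] product_integral_prod[of UNIV ?f, OF _ int]
      by (simp add: has_bochner_integral_iff)
  qed
  then show ?thesis
    using assms by (auto simp: centred_def intro!: prob_space_PiM)
qed

text \<open>By independence the mixed term integrates to a product of two zero means. With
  \<open>p\<close> and \<open>q\<close> of opposite sign this gives the private-noise part of the
  gap between two agents' actions.\<close>

lemma centred_PiM_two_components:
  fixes N :: "real measure"
  assumes N: "centred N (\<lambda>e. e) v" and "i \<noteq> j"
  shows "centred (\<Pi>\<^sub>M i\<in>(UNIV :: 'n::finite set). N) (\<lambda>\<epsilon>. p * \<epsilon> i + q * \<epsilon> j) ((p\<^sup>2 + q\<^sup>2) * v)"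
proof -
  let ?P = "\<Pi>\<^sub>M i\<in>(UNIV :: 'n set). N"
  interpret N: prob_space N using N by (simp add: centred_def)
  interpret product_sigma_finite "\<lambda>_ :: 'n. N" by standard
  let ?f = "\<lambda>k e :: real. if k \<in> {i, j} then e else 1"
  have int: "integrable N (?f k)" for k
    using N by (cases "k \<in> {i, j}") (auto simp: centred_def has_bochner_integral_iff)
  have "(\<Prod>k\<in>UNIV. ?f k (\<epsilon> k)) = \<epsilon> i * \<epsilon> j" for \<epsilon>
    using \<open>i \<noteq> j\<close> by (subst prod.remove[of _ i], simp, simp, subst prod.remove[of _ j]) auto
  moreover have "(\<Prod>k\<in>UNIV. integral\<^sup>L N (?f k)) = 0"
    \<comment> \<open>The factor of coordinate \<open>i\<close> is the mean of the noise, which is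
      zero, so the whole product vanishes.\<close>
    using N by (subst prod.remove[of _ i]) (auto simp: centred_def has_bochner_integral_iff)
  ultimately have cross: "has_bochner_integral ?P (\<lambda>\<epsilon>. \<epsilon> i * \<epsilon> j) 0"
    using product_integrable_prod[of UNIV ?f, OF _ int] product_integral_prod[of UNIV ?f, OF _ int]
    by (simp add: has_bochner_integral_iff)
  note comp = centred_PiM_component[OF N, of i] centred_PiM_component[OF N, of j]
  have "has_bochner_integral ?P (\<lambda>\<epsilon>. p * \<epsilon> i + q * \<epsilon> j) (p * 0 + q * 0)"
    using comp unfolding centred_def
    by (intro has_bochner_integral_add has_bochner_integral_mult_right) auto
  moreover have "has_bochner_integral ?P (\<lambda>\<epsilon>. p\<^sup>2 * (\<epsilon> i)\<^sup>2 + q\<^sup>2 * (\<epsilon> j)\<^sup>2 + 2 * p * q * (\<epsilon> i * \<epsilon> j))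
      (p\<^sup>2 * v + q\<^sup>2 * v + 2 * p * q * 0)"
    using comp cross unfolding centred_def
    by (intro has_bochner_integral_add has_bochner_integral_mult_right) auto
  ultimately show ?thesis
    using comp by (simp add: centred_def power2_sum power_mult_distrib algebra_simps)
qed

lemma has_bochner_integral_pair_mult:
  fixes f :: "'a \<Rightarrow> real" and g :: "'b \<Rightarrow> real"
  assumes "prob_space M" "prob_space N"
    and f: "has_bochner_integral M f c" and g: "has_bochner_integral N g d"
  shows "has_bochner_integral (M \<Otimes>\<^sub>M N) (\<lambda>\<omega>. f (fst \<omega>) * g (snd \<omega>)) (c * d)"
proof -
  interpret M: prob_space M by fact
  interpret N: prob_space N by fact
  interpret pair_sigma_finite M N by standard
  have fg: "integrable M f" "integrable N g" "integral\<^sup>L M f = c" "integral\<^sup>L N g = d"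
    using f g by (auto simp: has_bochner_integral_iff)
  have [measurable]: "f \<in> borel_measurable M" "g \<in> borel_measurable N"
    using fg by auto
  have "integrable (M \<Otimes>\<^sub>M N) (\<lambda>\<omega>. f (fst \<omega>) * g (snd \<omega>))"
    by (rule Fubini_integrable) (use fg in \<open>auto simp: abs_mult\<close>)
  then show ?thesis
    using integral_fst'[of "\<lambda>\<omega>. f (fst \<omega>) * g (snd \<omega>)"] fg by (simp add: has_bochner_integral_iff)
qed

text \<open>Independence of private and public noise: the mixed term has integral
  \<open>0 * 0\<close>. Only \<open>Y\<close> needs a coefficient, since a weight on the first term
  can be absorbed into \<open>X\<close>.\<close>

lemma centred_pair:
  assumes X: "centred M X v" and Y: "centred N Y w"
  shows "centred (M \<Otimes>\<^sub>M N) (\<lambda>\<omega>. X (fst \<omega>) + q * Y (snd \<omega>)) (v + q\<^sup>2 * w)"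
proof -
  have P: "prob_space M" "prob_space N" using X Y by (auto simp: centred_def)
  note pair = has_bochner_integral_pair_mult[OF P]
  have const: "has_bochner_integral M (\<lambda>_. 1 :: real) 1" "has_bochner_integral N (\<lambda>_. 1 :: real) 1"
    by (rule has_bochner_integral_const, fact P)+
  \<comment> \<open>The factors 1 bring every summand into the form
    \<open>f (fst \<omega>) * g (snd \<omega>)\<close>.\<close>
  have "has_bochner_integral (M \<Otimes>\<^sub>M N) (\<lambda>\<omega>. X (fst \<omega>) * 1 + q * (1 * Y (snd \<omega>)))
      (0 * 1 + q * (1 * 0))"
    using X Y const unfolding centred_def
    by (intro has_bochner_integral_add has_bochner_integral_mult_right
          pair[where f = X and g = "\<lambda>_. 1"] pair[where f = "\<lambda>_. 1" and g = Y]) auto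
  moreover have "has_bochner_integral (M \<Otimes>\<^sub>M N)
      (\<lambda>\<omega>. (X (fst \<omega>))\<^sup>2 * 1 + q\<^sup>2 * (1 * (Y (snd \<omega>))\<^sup>2) + 2 * q * (X (fst \<omega>) * Y (snd \<omega>)))
      (v * 1 + q\<^sup>2 * (1 * w) + 2 * q * (0 * 0))"
    using X Y const unfolding centred_def
    by (intro has_bochner_integral_add has_bochner_integral_mult_right pair[where f = X and g = Y]
          pair[where f = "\<lambda>x. (X x)\<^sup>2" and g = "\<lambda>_. 1"]
          pair[where f = "\<lambda>_. 1" and g = "\<lambda>y. (Y y)\<^sup>2"]) auto
  ultimately show ?thesis
    using prob_space_pair[OF P] by (simp add: centred_def power2_sum power_mult_distrib algebra_simps)
qed

section \<open>Quadratic payoffs and best replies\<close>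

lemma sum_off_diagonal:
  assumes "interaction_network G"
  shows "(\<Sum>j\<in>UNIV - {i}. G $ i $ j * f j) = (\<Sum>j\<in>UNIV. G $ i $ j * f j)"
    and "(\<Sum>j\<in>UNIV - {i}. G $ j $ i * f j) = (\<Sum>j\<in>UNIV. G $ j $ i * f j)"
  using assms by (auto intro!: sum.mono_neutral_left simp: interaction_network_def)

lemma out_degree_eq: "interaction_network G \<Longrightarrow> out_degree G i = (\<Sum>j\<in>UNIV. G $ i $ j)"
  and in_degree_eq: "interaction_network G \<Longrightarrow> in_degree G i = (\<Sum>j\<in>UNIV. G $ j $ i)"
  using sum_off_diagonal[where f = "\<lambda>_. 1"] by (simp_all add: out_degree_def in_degree_def)

text \<open>The state may depend on \<omega>, so that the lemma serves both for integrating out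
  noise at a fixed state and for integrating out the state under its posterior.\<close>

lemma payoff_expectation:
  assumes "has_bochner_integral M (\<lambda>\<omega>. (a \<omega> i - \<theta> \<omega>)\<^sup>2) V"
    and "\<And>j. j \<noteq> i \<Longrightarrow> has_bochner_integral M (\<lambda>\<omega>. (a \<omega> i - a \<omega> j)\<^sup>2) (D j)"
  shows "has_bochner_integral M (\<lambda>\<omega>. payoff G i (a \<omega>) (\<theta> \<omega>))
    (- (1 - out_degree G i) * V - (\<Sum>j\<in>UNIV - {i}. G $ i $ j * D j))"
  unfolding payoff_def out_degree_def using assms
  by (intro has_bochner_integral_diff has_bochner_integral_sum has_bochner_integral_mult_right) auto

text \<open>The maximiser of the payoff of \<open>i\<close> when the state \<open>m\<close> and the
  actions of the others are known; its weights on \<open>m\<close> and on the \<open>a j\<close> sum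
  to 1.\<close>

definition best_reply :: "real ^ 'n ^ 'n \<Rightarrow> 'n::finite \<Rightarrow> ('n \<Rightarrow> real) \<Rightarrow> real \<Rightarrow> real" where
  "best_reply G i a m = (1 - out_degree G i) * m + (\<Sum>j\<in>UNIV - {i}. G $ i $ j * a j)"

text \<open>The weights on the squared gaps sum to 1, so \<open>b\<close> squared has coefficient -1
  and completing the square leaves a remainder free of \<open>b\<close>.\<close>

lemma payoff_deviation:
  "payoff G i (a(i := b)) m = - (b - best_reply G i a m)\<^sup>2 + ((best_reply G i a m)\<^sup>2
     - (1 - out_degree G i) * m\<^sup>2 - (\<Sum>j\<in>UNIV - {i}. G $ i $ j * (a j)\<^sup>2))"
proof -
  have "(\<Sum>j\<in>UNIV - {i}. G $ i $ j * ((a(i := b)) i - (a(i := b)) j)\<^sup>2)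
      = (\<Sum>j\<in>UNIV - {i}. b\<^sup>2 * G $ i $ j - 2 * b * (G $ i $ j * a j) + G $ i $ j * (a j)\<^sup>2)"
    by (intro sum.cong) (auto simp: power2_diff algebra_simps)
  also have "\<dots> = b\<^sup>2 * out_degree G i - 2 * b * (\<Sum>j\<in>UNIV - {i}. G $ i $ j * a j)
      + (\<Sum>j\<in>UNIV - {i}. G $ i $ j * (a j)\<^sup>2)"
    by (simp add: sum.distrib sum_subtractf sum_distrib_left out_degree_def)
  finally show ?thesis
    unfolding payoff_def best_reply_def out_degree_def[symmetric]
    by (simp add: power2_eq_square algebra_simps)
qed

text \<open>Certainty equivalence: uncertainty costs an amount independent of \<open>b\<close>, so
  the payoff may be evaluated at the posterior mean. Each squared gap gains a variance, first from
  the others' noise at a fixed state, then from the state itself. The factor \<open>C\<close>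
  cancels in the normalisation.\<close>

lemma interim_payoff_affine:
  fixes G :: "real ^ 'n ^ 'n::finite"
  assumes "0 < \<tau>" "0 < \<sigma>" "0 < C"
  shows "interim_payoff G \<tau> i (\<lambda>\<theta>. C * normal_density m \<sigma> \<theta>) (\<lambda>j x. A j * x + B j) b
    = payoff G i ((\<lambda>j. A j * m + B j)(i := b)) m - (1 - out_degree G i) * \<sigma>\<^sup>2
      - (\<Sum>j\<in>UNIV - {i}. G $ i $ j * ((A j)\<^sup>2 * (\<sigma>\<^sup>2 + 1 / \<tau>)))"
proof -
  \<comment> \<open>Loss caused by the private noise of the others.\<close>
  define V where "V = (\<Sum>j\<in>UNIV - {i}. G $ i $ j * ((A j)\<^sup>2 * (1 / \<tau>)))"
  have inner: "(\<integral>\<epsilon>. payoff G i ((\<lambda>j. A j * (\<theta> + \<epsilon> j) + B j)(i := b)) \<theta> \<partial>private_noise \<tau>)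
      = payoff G i ((\<lambda>j. A j * \<theta> + B j)(i := b)) \<theta> - V" (is "_ = ?q \<theta> - V") for \<theta>
  proof (rule has_bochner_integral_integral_eq)
    have c: "centred (private_noise \<tau>) (\<lambda>\<epsilon>. \<epsilon> j) (1 / \<tau>)" for j :: 'n
      unfolding private_noise_def by (intro centred_PiM_component centred_noise assms)
    have "has_bochner_integral (private_noise \<tau>)
        (\<lambda>\<epsilon>. payoff G i ((\<lambda>j. A j * (\<theta> + \<epsilon> j) + B j)(i := b)) \<theta>)
        (- (1 - out_degree G i) * (b - \<theta>)\<^sup>2 - (\<Sum>j\<in>UNIV - {i}. G $ i $ j *
          ((b - (A j * \<theta> + B j))\<^sup>2 + (- A j)\<^sup>2 * (1 / \<tau>))))"
    proof (rule payoff_expectation)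
      show "has_bochner_integral (private_noise \<tau> :: ('n \<Rightarrow> real) measure)
          (\<lambda>\<epsilon>. (((\<lambda>j. A j * (\<theta> + \<epsilon> j) + B j)(i := b)) i - \<theta>)\<^sup>2) ((b - \<theta>)\<^sup>2)"
        using c by (simp add: has_bochner_integral_const centred_def)
    next
      fix j assume "j \<noteq> i"
      then show "has_bochner_integral (private_noise \<tau>)
          (\<lambda>\<epsilon>. (((\<lambda>j. A j * (\<theta> + \<epsilon> j) + B j)(i := b)) i - ((\<lambda>j. A j * (\<theta> + \<epsilon> j) + B j)(i := b)) j)\<^sup>2)
          ((b - (A j * \<theta> + B j))\<^sup>2 + (- A j)\<^sup>2 * (1 / \<tau>))"
        using centred_affine[OF c, of "b - (A j * \<theta> + B j)" "- A j" j] by (simp add: algebra_simps)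
    qed
    also have "- (1 - out_degree G i) * (b - \<theta>)\<^sup>2 - (\<Sum>j\<in>UNIV - {i}. G $ i $ j *
          ((b - (A j * \<theta> + B j))\<^sup>2 + (- A j)\<^sup>2 * (1 / \<tau>))) = ?q \<theta> - V"
      by (simp add: payoff_def out_degree_def V_def sum.distrib distrib_left)
    finally show "has_bochner_integral (private_noise \<tau>)
      (\<lambda>\<epsilon>. payoff G i ((\<lambda>j. A j * (\<theta> + \<epsilon> j) + B j)(i := b)) \<theta>) (?q \<theta> - V)" .
  qed
  define N where "N = density lborel (normal_density m \<sigma>)"
  \<comment> \<open>Loss caused by the posterior uncertainty about the state.\<close>
  define W where "W = (1 - out_degree G i) * \<sigma>\<^sup>2 + (\<Sum>j\<in>UNIV - {i}. G $ i $ j * ((A j)\<^sup>2 * \<sigma>\<^sup>2))"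
  have c: "centred N (\<lambda>\<theta>. \<theta> - m) (\<sigma>\<^sup>2)"
    unfolding N_def by (rule centred_normal) fact
  have q: "has_bochner_integral N ?q
      (- (1 - out_degree G i) * ((b - m)\<^sup>2 + (- 1)\<^sup>2 * \<sigma>\<^sup>2) - (\<Sum>j\<in>UNIV - {i}. G $ i $ j *
          ((b - (A j * m + B j))\<^sup>2 + (- A j)\<^sup>2 * \<sigma>\<^sup>2)))"
  proof (rule payoff_expectation)
    show "has_bochner_integral N (\<lambda>\<theta>. (((\<lambda>j. A j * \<theta> + B j)(i := b)) i - \<theta>)\<^sup>2)
        ((b - m)\<^sup>2 + (- 1)\<^sup>2 * \<sigma>\<^sup>2)"
      using centred_affine[OF c, of "b - m" "- 1"] by simp
  next
    fix j assume "j \<noteq> i"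
    then show "has_bochner_integral N
        (\<lambda>\<theta>. (((\<lambda>j. A j * \<theta> + B j)(i := b)) i - ((\<lambda>j. A j * \<theta> + B j)(i := b)) j)\<^sup>2)
        ((b - (A j * m + B j))\<^sup>2 + (- A j)\<^sup>2 * \<sigma>\<^sup>2)"
      using centred_affine[OF c, of "b - (A j * m + B j)" "- A j"] by (simp add: algebra_simps)
  qed
  also have "- (1 - out_degree G i) * ((b - m)\<^sup>2 + (- 1)\<^sup>2 * \<sigma>\<^sup>2) - (\<Sum>j\<in>UNIV - {i}. G $ i $ j *
          ((b - (A j * m + B j))\<^sup>2 + (- A j)\<^sup>2 * \<sigma>\<^sup>2)) = ?q m - W"
    by (simp add: payoff_def out_degree_def W_def sum.distrib distrib_left algebra_simps)
  finally have "has_bochner_integral N (\<lambda>\<theta>. ?q \<theta> - V) (?q m - W - V)"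
    using c by (auto simp: centred_def intro!: has_bochner_integral_diff has_bochner_integral_const)
  moreover have "?q \<in> borel_measurable borel"
    using borel_measurable_has_bochner_integral[OF q] by (simp add: N_def)
  ultimately have "(\<integral>\<theta>. normal_density m \<sigma> \<theta> * (?q \<theta> - V) \<partial>lborel) = ?q m - W - V"
    using integral_density[of "\<lambda>\<theta>. ?q \<theta> - V" lborel "normal_density m \<sigma>"]
    by (simp add: has_bochner_integral_iff N_def)
  then have "(\<integral>\<theta>. C * normal_density m \<sigma> \<theta> * (?q \<theta> - V) \<partial>lborel) = C * (?q m - W - V)"
    by (simp add: mult.assoc)
  then have "interim_payoff G \<tau> i (\<lambda>\<theta>. C * normal_density m \<sigma> \<theta>) (\<lambda>j x. A j * x + B j) b = ?q m - W - V"
    using assms by (simp add: interim_payoff_def inner integral_normal_density del: fun_upd_apply)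
  then show ?thesis
    by (simp add: V_def W_def distrib_left sum.distrib algebra_simps del: fun_upd_apply)
qed

text \<open>The interim payoff is a concave parabola in \<open>b\<close> with its peak at the best
  reply. \<open>L\<close> and \<open>s\<close> enter through equations so that the games with and
  without public signal are both instances.\<close>

lemma interim_payoff_maximal_iff:
  fixes G :: "real ^ 'n ^ 'n::finite"
  assumes "0 < \<tau>" "0 < \<sigma>" "0 < C"
    and L: "L = (\<lambda>\<theta>. C * normal_density m \<sigma> \<theta>)"
    and s: "\<And>j x. s j x = A j * x + B j"
  shows "(\<forall>b. interim_payoff G \<tau> i L s b \<le> interim_payoff G \<tau> i L s c)
    \<longleftrightarrow> c = best_reply G i (\<lambda>j. s j m) m"
proof -
  let ?t = "best_reply G i (\<lambda>j. s j m) m"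
  have s': "s = (\<lambda>j x. A j * x + B j)"
    using s by auto
  define K where "K = ?t\<^sup>2 - (1 - out_degree G i) * m\<^sup>2
      - (\<Sum>j\<in>UNIV - {i}. G $ i $ j * (s j m)\<^sup>2) - (1 - out_degree G i) * \<sigma>\<^sup>2
      - (\<Sum>j\<in>UNIV - {i}. G $ i $ j * ((A j)\<^sup>2 * (\<sigma>\<^sup>2 + 1 / \<tau>)))"
  have "interim_payoff G \<tau> i L s b = K - (b - ?t)\<^sup>2" for b
    unfolding K_def L s' interim_payoff_affine[OF assms(1-3)] payoff_deviation by simp
  then have "(\<forall>b. interim_payoff G \<tau> i L s b \<le> interim_payoff G \<tau> i L s c)
      \<longleftrightarrow> (\<forall>b. (c - ?t)\<^sup>2 \<le> (b - ?t)\<^sup>2)"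
    by simp
  also have "\<dots> \<longleftrightarrow> c = ?t"
    by (auto dest: spec[of _ ?t])
  finally show ?thesis .
qed

section \<open>Posterior of the state and equilibrium conditions\<close>

lemma normal_density_precision:
  "0 < \<tau> \<Longrightarrow> normal_density m (1 / sqrt \<tau>) x = sqrt (\<tau> / (2 * pi)) * exp (- \<tau> * (x - m)\<^sup>2 / 2)"
  by (simp add: normal_density_def power_divide real_sqrt_divide real_sqrt_mult field_simps)

text \<open>Completing the square in \<theta>: precisions add up and the mean is the
  precision-weighted average of the signals.\<close>

lemma likelihood_mult:
  assumes "0 < \<tau>x" "0 < \<tau>y" "\<gamma> = \<tau>x / (\<tau>x + \<tau>y)"
  obtains C where "0 < C" and "(\<lambda>\<theta>. likelihood \<tau>x x \<theta> * likelihood \<tau>y y \<theta>)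
    = (\<lambda>\<theta>. C * normal_density (\<gamma> * x + (1 - \<gamma>) * y) (1 / sqrt (\<tau>x + \<tau>y)) \<theta>)"
proof
  let ?\<tau> = "\<tau>x + \<tau>y" and ?r = "\<lambda>\<tau>. sqrt (\<tau> / (2 * pi))"
  \<comment> \<open>The part of the exponent left over by the completed square; it is free of
    \<theta> and goes into the constant.\<close>
  let ?e = "- (\<tau>x * \<tau>y / (\<tau>x + \<tau>y)) * (x - y)\<^sup>2 / 2"
  let ?C = "?r \<tau>x * ?r \<tau>y / ?r ?\<tau> * exp ?e"
  show "0 < ?C"
    using assms by simp
  show "(\<lambda>\<theta>. likelihood \<tau>x x \<theta> * likelihood \<tau>y y \<theta>)
    = (\<lambda>\<theta>. ?C * normal_density (\<gamma> * x + (1 - \<gamma>) * y) (1 / sqrt ?\<tau>) \<theta>)"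
  proof
    fix \<theta>
    have "?\<tau> \<noteq> 0" using assms by simp
    then have \<tau>: "\<tau>x = \<gamma> * ?\<tau>" "\<tau>y = (1 - \<gamma>) * ?\<tau>"
      unfolding assms(3) by (simp_all add: field_simps)
    have "\<tau>x * \<tau>y / ?\<tau> = \<gamma> * \<tau>y"
      using assms(3) by simp
    also have "\<dots> = \<gamma> * (1 - \<gamma>) * ?\<tau>"
      by (simp only: \<tau>(2)[symmetric] mult.assoc)
    finally have "\<tau>x * \<tau>y / ?\<tau> = \<gamma> * (1 - \<gamma>) * ?\<tau>" .
    \<comment> \<open>Stated for a free total precision \<open>T\<close>, the identity is polynomial
      and contains no division.\<close>
    moreover have "\<gamma> * T * (x - \<theta>)\<^sup>2 + (1 - \<gamma>) * T * (y - \<theta>)\<^sup>2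
        = \<gamma> * (1 - \<gamma>) * T * (x - y)\<^sup>2 + T * (\<theta> - (\<gamma> * x + (1 - \<gamma>) * y))\<^sup>2" for T
      by algebra
    from this[of ?\<tau>, folded \<tau>] have "\<tau>x * (x - \<theta>)\<^sup>2 + \<tau>y * (y - \<theta>)\<^sup>2
        = \<gamma> * (1 - \<gamma>) * ?\<tau> * (x - y)\<^sup>2 + ?\<tau> * (\<theta> - (\<gamma> * x + (1 - \<gamma>) * y))\<^sup>2" .
    ultimately have "- \<tau>x * (x - \<theta>)\<^sup>2 / 2 + - \<tau>y * (y - \<theta>)\<^sup>2 / 2
        = ?e + - ?\<tau> * (\<theta> - (\<gamma> * x + (1 - \<gamma>) * y))\<^sup>2 / 2"
      by (simp only:) (simp add: algebra_simps flip: add_divide_distrib)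
    moreover have "?r ?\<tau> \<noteq> 0" using assms by simp
    ultimately show "likelihood \<tau>x x \<theta> * likelihood \<tau>y y \<theta>
        = ?C * normal_density (\<gamma> * x + (1 - \<gamma>) * y) (1 / sqrt ?\<tau>) \<theta>"
      using assms by (simp add: likelihood_def normal_density_precision mult_exp_exp mult_ac
          del: real_sqrt_eq_zero_cancel_iff)
  qed
qed

text \<open>At fixed \<open>y\<close> the term in \<open>y\<close> is part of the intercept, so
  strategies are affine in the private signal. The expected action of \<open>j\<close> is then
  \<open>s j\<close> at the posterior mean \<open>m\<close>, used in place of the private
  signal.\<close>

lemma linear_BNE_iff:
  assumes "0 < \<tau>x" "0 < \<tau>y" "\<gamma> = \<tau>x / (\<tau>x + \<tau>y)"
  shows "linear_BNE G \<tau>x \<tau>y s \<longleftrightarrow>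
    (\<forall>i. \<exists>\<alpha> \<beta> \<kappa>. \<forall>x y. s i x y = \<alpha> * x + \<beta> * y + \<kappa>) \<and>
    (\<forall>i x y. let m = \<gamma> * x + (1 - \<gamma>) * y in s i x y = best_reply G i (\<lambda>j. s j m y) m)"
  unfolding linear_BNE_def
proof (intro conj_cong refl all_cong1)
  fix i x y
  assume "\<forall>i. \<exists>\<alpha> \<beta> \<kappa>. \<forall>x y. s i x y = \<alpha> * x + \<beta> * y + \<kappa>"
  then obtain \<alpha> \<beta> \<kappa> where s: "\<And>i x y. s i x y = \<alpha> i * x + (\<beta> i * y + \<kappa> i)"
    unfolding choice_iff by (auto simp: add.assoc)
  obtain C where "0 < C" "(\<lambda>\<theta>. likelihood \<tau>x x \<theta> * likelihood \<tau>y y \<theta>)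
    = (\<lambda>\<theta>. C * normal_density (\<gamma> * x + (1 - \<gamma>) * y) (1 / sqrt (\<tau>x + \<tau>y)) \<theta>)"
    using likelihood_mult[OF assms] .
  with assms s show "(\<forall>b. let U = interim_payoff G \<tau>x i (\<lambda>\<theta>. likelihood \<tau>x x \<theta> * likelihood \<tau>y y \<theta>)
        (\<lambda>j x'. s j x' y) in U b \<le> U (s i x y)) \<longleftrightarrow>
      (let m = \<gamma> * x + (1 - \<gamma>) * y in s i x y = best_reply G i (\<lambda>j. s j m y) m)"
    unfolding Let_def by (intro interim_payoff_maximal_iff) auto
qed

text \<open>The normal density is symmetric in mean and argument, so the likelihood of
  \<open>x\<close> is already the posterior density, with mean \<open>x\<close>.\<close>

lemma linear_BNE_private_iff:
  assumes "0 < \<tau>x"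
  shows "linear_BNE_private G \<tau>x s \<longleftrightarrow>
    (\<forall>i. \<exists>\<alpha> \<kappa>. \<forall>x. s i x = \<alpha> * x + \<kappa>) \<and> (\<forall>i x. s i x = best_reply G i (\<lambda>j. s j x) x)"
  unfolding linear_BNE_private_def
proof (intro conj_cong refl all_cong1)
  fix i x
  assume "\<forall>i. \<exists>\<alpha> \<kappa>. \<forall>x. s i x = \<alpha> * x + \<kappa>"
  then obtain \<alpha> \<kappa> where s: "\<And>i x. s i x = \<alpha> i * x + \<kappa> i"
    unfolding choice_iff by auto
  have "likelihood \<tau>x x = (\<lambda>\<theta>. 1 * normal_density x (1 / sqrt \<tau>x) \<theta>)"
    by (simp add: likelihood_def fun_eq_iff normal_density_def power2_commute)
  with assms s show "(\<forall>b. let U = interim_payoff G \<tau>x i (likelihood \<tau>x x) s in U b \<le> U (s i x))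
      \<longleftrightarrow> s i x = best_reply G i (\<lambda>j. s j x) x"
    unfolding Let_def
    by (intro interim_payoff_maximal_iff[where C = 1 and \<sigma> = "1 / sqrt \<tau>x"]) auto
qed

section \<open>Fixed points on the network and Katz-Bonacich centrality\<close>

text \<open>Because the weights sum to 1, actions can be measured as deviations from
  \<open>m\<close>, which makes the equilibrium conditions linear in \<open>G\<close>.\<close>

lemma best_reply_network:
  "interaction_network G \<Longrightarrow>
    best_reply G i a m = m + (\<Sum>j\<in>UNIV. G $ i $ j * (a j - m))"
  unfolding best_reply_def sum_off_diagonal(1)
  by (simp add: out_degree_eq left_diff_distrib right_diff_distrib sum_subtractf sum_distrib_right)

text \<open>Maximum principle: at an agent \<open>k\<close> where the absolute value of
  \<open>z\<close> is largest, it is at most \<open>out_degree G k\<close> times itself, and that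
  degree is below 1. The case \<gamma> = 1 is included for the private game and for the intercepts
  in the public one.\<close>

lemma network_fixed_point_eq_0:
  fixes z :: "'n::finite \<Rightarrow> real"
  assumes G: "interaction_network G" and \<gamma>: "0 \<le> \<gamma>" "\<gamma> \<le> 1"
    and z: "\<And>i. z i = \<gamma> * (\<Sum>j\<in>UNIV. G $ i $ j * z j)"
  shows "z i = 0"
proof -
  obtain k where k: "\<And>j. \<bar>z j\<bar> \<le> \<bar>z k\<bar>"
  proof -
    have "Max (range (\<lambda>j. \<bar>z j\<bar>)) \<in> range (\<lambda>j. \<bar>z j\<bar>)"
      by (rule Max_in) auto
    then obtain k where "Max (range (\<lambda>j. \<bar>z j\<bar>)) = \<bar>z k\<bar>" by (rule imageE)
    then show ?thesis
      by (intro that[of k]) (metis Max_ge finite finite_imageI rangeI)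
  qed
  have "\<bar>z k\<bar> = \<gamma> * \<bar>\<Sum>j\<in>UNIV. G $ k $ j * z j\<bar>"
    using \<gamma> by (subst z) (simp add: abs_mult)
  also have "\<dots> \<le> 1 * (\<Sum>j\<in>UNIV. \<bar>G $ k $ j * z j\<bar>)"
    using \<gamma> by (intro mult_mono sum_abs) auto
  also have "\<dots> \<le> (\<Sum>j\<in>UNIV. G $ k $ j * \<bar>z k\<bar>)"
    using G k by (auto simp: abs_mult interaction_network_def intro!: sum_mono mult_mono)
  also have "\<dots> = out_degree G k * \<bar>z k\<bar>"
    by (simp add: out_degree_eq[OF G] sum_distrib_right)
  finally have "(1 - out_degree G k) * \<bar>z k\<bar> \<le> 0"
    by (simp add: algebra_simps)
  moreover have "out_degree G k < 1"
    using G by (simp add: interaction_network_def)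
  ultimately have "\<bar>z k\<bar> = 0"
    by (simp add: mult_le_0_iff)
  then show ?thesis using k[of i] by simp
qed

text \<open>The system \<open>(I - \<gamma> G) c = 1\<close> read row by row. The maximum principle
  gives the matrix a trivial kernel, hence invertibility, so that \<open>matrix_inv\<close> is a
  genuine inverse.\<close>

lemma katz_bonacich_fixed_point:
  assumes G: "interaction_network G" and \<gamma>: "0 \<le> \<gamma>" "\<gamma> \<le> 1"
  shows "katz_bonacich \<gamma> G $ i = 1 + \<gamma> * (\<Sum>j\<in>UNIV. G $ i $ j * katz_bonacich \<gamma> G $ j)"
proof -
  let ?M = "mat 1 - \<gamma> *\<^sub>R G"
  have M: "(?M *v v) $ i = v $ i - \<gamma> * (\<Sum>j\<in>UNIV. G $ i $ j * v $ j)" for v i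
    by (simp add: matrix_vector_mult_diff_rdistrib scaleR_matrix_vector_assoc[symmetric])
       (simp add: matrix_vector_mult_def)
  have "v = 0" if "?M *v v = 0" for v
  proof -
    have "v $ i = \<gamma> * (\<Sum>j\<in>UNIV. G $ i $ j * v $ j)" for i
      using M[of v i] that by simp
    from network_fixed_point_eq_0[OF G \<gamma> this] show ?thesis
      by (simp add: vec_eq_iff)
  qed
  then have "invertible ?M"
    unfolding invertible_left_inverse matrix_left_invertible_ker by blast
  then have "?M ** matrix_inv ?M = mat 1"
    unfolding invertible_def matrix_inv_def by (rule someI2_ex) auto
  then have "?M *v katz_bonacich \<gamma> G = (\<chi> i. 1)"
    by (simp add: katz_bonacich_def matrix_vector_mul_assoc)
  then show ?thesis
    using M[of "katz_bonacich \<gamma> G" i] by simp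
qed

section \<open>Existence, uniqueness and form of the two equilibria\<close>

text \<open>The deviations \<open>s j x - x\<close> form a fixed point of \<open>G\<close> and
  therefore vanish. Both directions are proved because \<open>THE\<close> can be evaluated only at a
  unique equilibrium.\<close>

lemma equilibrium_private_eq:
  assumes G: "interaction_network G" and "0 < \<tau>x"
  shows "equilibrium_private G \<tau>x i x = x"
proof -
  have "linear_BNE_private G \<tau>x s \<longleftrightarrow> s = (\<lambda>i x. x)" for s
  proof
    assume "linear_BNE_private G \<tau>x s"
    then have "s i x = x + (\<Sum>j\<in>UNIV. G $ i $ j * (s j x - x))" for i x
      unfolding linear_BNE_private_iff[OF \<open>0 < \<tau>x\<close>] best_reply_network[OF G] by blast
    then have "s i x - x = 1 * (\<Sum>j\<in>UNIV. G $ i $ j * (s j x - x))" for i x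
      by (metis add_diff_cancel_left' mult_1)
    from network_fixed_point_eq_0[OF G _ _ this] show "s = (\<lambda>i x. x)"
      by (simp add: fun_eq_iff)
  next
    assume "s = (\<lambda>i x. x)"
    then show "linear_BNE_private G \<tau>x s"
      using assms by (auto simp: linear_BNE_private_iff best_reply_network intro: exI[of _ 1] exI[of _ 0])
  qed
  then show ?thesis
    by (simp add: equilibrium_private_def)
qed

lemma equilibrium_eq:
  assumes G: "interaction_network G" and \<tau>: "0 < \<tau>x" "0 < \<tau>y" and \<gamma>: "\<gamma> = \<tau>x / (\<tau>x + \<tau>y)"
  shows "equilibrium G \<tau>x \<tau>y i x y
    = (1 - \<gamma>) * katz_bonacich \<gamma> G $ i * y + (1 - (1 - \<gamma>) * katz_bonacich \<gamma> G $ i) * x"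
proof -
  let ?c = "\<lambda>i. katz_bonacich \<gamma> G $ i"
  define S where "S = (\<lambda>i x y. (1 - \<gamma>) * ?c i * y + (1 - (1 - \<gamma>) * ?c i) * x)"
  have \<gamma>01: "0 \<le> \<gamma>" "\<gamma> \<le> 1"
    using \<tau> \<gamma> by auto
  note c = katz_bonacich_fixed_point[OF G \<gamma>01]
  have S_reply: "S i x y = best_reply G i (\<lambda>j. S j (\<gamma> * x + (1 - \<gamma>) * y) y) (\<gamma> * x + (1 - \<gamma>) * y)"
    for i x y
  proof -
    \<comment> \<open>At private signal \<open>m\<close>, the strategy \<open>S j\<close> deviates
      from \<open>m\<close> by its weight on \<open>y\<close> times \<open>y - m\<close>, and
      \<open>y - m\<close> equals \<open>\<gamma> * (y - x)\<close>.\<close>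
    have "(\<Sum>j\<in>UNIV. G $ i $ j * (S j (\<gamma> * x + (1 - \<gamma>) * y) y - (\<gamma> * x + (1 - \<gamma>) * y)))
       = (\<Sum>j\<in>UNIV. (1 - \<gamma>) * (y - x) * (\<gamma> * (G $ i $ j * ?c j)))"
      by (intro sum.cong) (auto simp: S_def algebra_simps)
    also have "\<dots> = (1 - \<gamma>) * (y - x) * (?c i - 1)"
      by (subst c[of i]) (simp add: sum_distrib_left[symmetric])
    finally show ?thesis
      unfolding best_reply_network[OF G] by (simp add: S_def algebra_simps)
  qed
  have "linear_BNE G \<tau>x \<tau>y s \<longleftrightarrow> s = S" for s
  proof
    assume s: "linear_BNE G \<tau>x \<tau>y s"
    then have reply: "s i x y = best_reply G i (\<lambda>j. s j (\<gamma> * x + (1 - \<gamma>) * y) y) (\<gamma> * x + (1 - \<gamma>) * y)"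
      for i x y
      using iffD1[OF linear_BNE_iff[OF \<tau> \<gamma>] s] unfolding Let_def by blast
    from s obtain \<alpha> \<beta> \<kappa> where "\<And>i x y. s i x y = \<alpha> i * x + \<beta> i * y + \<kappa> i"
      unfolding linear_BNE_def choice_iff by auto
    \<comment> \<open>The coordinates \<open>x - y\<close> and \<open>y\<close> suit the reply map:
      passing from \<open>x\<close> to the posterior mean multiplies the first by \<gamma> and fixes
      the second.\<close>
    then obtain a b where d: "\<And>i x y. s i x y - S i x y = a i * (x - y) + b i y"
      by (rule_tac that[of "\<lambda>i. \<alpha> i - (1 - (1 - \<gamma>) * ?c i)"
            "\<lambda>i y. (\<alpha> i + \<beta> i - 1) * y + \<kappa> i"]) (simp add: S_def algebra_simps)
    \<comment> \<open>Setting \<open>x = y\<close> in this equation decouples \<open>b\<close> from \<open>a\<close>.\<close>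
    have fp: "a i * (x - y) + b i y = (\<Sum>j\<in>UNIV. G $ i $ j * (a j * (\<gamma> * (x - y)) + b j y))" for i x y
    proof -
      let ?m = "\<gamma> * x + (1 - \<gamma>) * y"
      have "s i x y - S i x y = (\<Sum>j\<in>UNIV. G $ i $ j * (s j ?m y - S j ?m y))"
        by (subst reply, subst S_reply)
           (simp add: best_reply_network[OF G] right_diff_distrib sum_subtractf)
      moreover have "?m - y = \<gamma> * (x - y)"
        by (simp add: algebra_simps)
      ultimately show ?thesis
        by (simp add: d)
    qed
    have "b i y = 1 * (\<Sum>j\<in>UNIV. G $ i $ j * b j y)" for i y
      using fp[of i y y] by simp
    from network_fixed_point_eq_0[OF G _ _ this] have b: "b i y = 0" for i y
      by simp
    have "a i = \<gamma> * (\<Sum>j\<in>UNIV. G $ i $ j * a j)" for i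
      using fp[of i 1 0] by (simp add: b sum_distrib_left mult_ac)
    from network_fixed_point_eq_0[OF G \<gamma>01 this] have "a i = 0" for i
      by simp
    with b d show "s = S"
      by (simp add: fun_eq_iff)
  next
    assume "s = S"
    moreover have "\<exists>\<alpha> \<beta> \<kappa>. \<forall>x y. S i x y = \<alpha> * x + \<beta> * y + \<kappa>" for i
      by (rule exI[of _ "1 - (1 - \<gamma>) * ?c i"], rule exI[of _ "(1 - \<gamma>) * ?c i"], rule exI[of _ 0])
         (simp add: S_def)
    ultimately show "linear_BNE G \<tau>x \<tau>y s"
      unfolding linear_BNE_iff[OF \<tau> \<gamma>] Let_def using S_reply by blast
  qed
  then show ?thesis
    by (simp add: equilibrium_def S_def)
qed

section \<open>Welfare\<close>

lemma centred_scale: "centred M X v \<Longrightarrow> centred M (\<lambda>\<omega>. q * X \<omega>) (q\<^sup>2 * v)"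
  using centred_affine[of M X v 0 q] has_bochner_integral_mult_right[of q M X 0]
  unfolding centred_def by simp

lemma centred_second_moment: "centred M X v \<Longrightarrow> has_bochner_integral M (\<lambda>\<omega>. (X \<omega>)\<^sup>2) v"
  by (simp add: centred_def)

text \<open>The gap to the state has variance \<open>1 / \<tau>x\<close> and the gap between two
  agents twice that, so the weights combine to \<open>(1 - d) + 2 * d\<close> with \<open>d\<close>
  the out-degree.\<close>

lemma welfare_private_eq:
  assumes G: "interaction_network G" and "0 < \<tau>x"
  shows "welfare_private \<theta> \<tau>x G = - (\<Sum>i\<in>UNIV. (1 + out_degree G i) / \<tau>x)"
proof -
  have c: "centred (noise \<tau>x) (\<lambda>e. e) (1 / \<tau>x)"
    by (rule centred_noise) fact
  have "has_bochner_integral (private_noise \<tau>x) (\<lambda>\<epsilon>. payoff G i (\<lambda>j. \<theta> + \<epsilon> j) \<theta>)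
      (- (1 - out_degree G i) * (1 / \<tau>x) - (\<Sum>j\<in>UNIV - {i}. G $ i $ j * (2 * (1 / \<tau>x))))" for i
  proof (rule payoff_expectation)
    show "has_bochner_integral (private_noise \<tau>x) (\<lambda>\<epsilon>. (\<theta> + \<epsilon> i - \<theta>)\<^sup>2) (1 / \<tau>x)"
      using centred_second_moment[OF centred_PiM_component[OF c]] by (simp add: private_noise_def)
  next
    fix j assume "j \<noteq> i"
    then show "has_bochner_integral (private_noise \<tau>x) (\<lambda>\<epsilon>. (\<theta> + \<epsilon> i - (\<theta> + \<epsilon> j))\<^sup>2) (2 * (1 / \<tau>x))"
      using centred_second_moment[OF centred_PiM_two_components[OF c, of i j 1 "- 1"]]
      by (simp add: private_noise_def)
  qed
  moreover have "- (1 - out_degree G i) * (1 / \<tau>x) - (\<Sum>j\<in>UNIV - {i}. G $ i $ j * (2 * (1 / \<tau>x)))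
      = - ((1 + out_degree G i) / \<tau>x)" for i
    unfolding sum_distrib_right[symmetric] out_degree_def[symmetric] using assms by (simp add: field_simps)
  ultimately show ?thesis
    unfolding welfare_private_def equilibrium_private_eq[OF assms] sum_negf[symmetric]
    by (intro sum.cong) (auto intro!: has_bochner_integral_integral_eq)
qed

text \<open>Each agent's weights on the two signals sum to 1, so the state cancels from all gaps. In
  the gap between two agents the common public noise keeps only the difference of their
  weights.\<close>

lemma welfare_eq:
  assumes G: "interaction_network G" and \<tau>: "0 < \<tau>x" "0 < \<tau>y" and \<gamma>: "\<gamma> = \<tau>x / (\<tau>x + \<tau>y)"
    and \<beta>: "\<And>i. \<beta> i = (1 - \<gamma>) * katz_bonacich \<gamma> G $ i"
  shows "welfare \<theta> \<tau>x \<tau>y G = (\<Sum>i\<in>UNIV.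
    - (1 - out_degree G i) * ((1 - \<beta> i)\<^sup>2 * (1 / \<tau>x) + (\<beta> i)\<^sup>2 * (1 / \<tau>y))
    - (\<Sum>j\<in>UNIV. G $ i $ j *
        (((1 - \<beta> i)\<^sup>2 + (1 - \<beta> j)\<^sup>2) * (1 / \<tau>x) + (\<beta> i - \<beta> j)\<^sup>2 * (1 / \<tau>y))))"
proof -
  note c = centred_noise[OF \<tau>(1)] and cy = centred_noise[OF \<tau>(2)]
  let ?P = "private_noise \<tau>x \<Otimes>\<^sub>M noise \<tau>y"
  let ?a = "\<lambda>\<omega> j. \<beta> j * (\<theta> + snd \<omega>) + (1 - \<beta> j) * (\<theta> + fst \<omega> j)"
  have "has_bochner_integral ?P (\<lambda>\<omega>. payoff G i (?a \<omega>) \<theta>)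
    (- (1 - out_degree G i) * ((1 - \<beta> i)\<^sup>2 * (1 / \<tau>x) + (\<beta> i)\<^sup>2 * (1 / \<tau>y))
    - (\<Sum>j\<in>UNIV - {i}. G $ i $ j *
        (((1 - \<beta> i)\<^sup>2 + (- (1 - \<beta> j))\<^sup>2) * (1 / \<tau>x) + (\<beta> i - \<beta> j)\<^sup>2 * (1 / \<tau>y))))" for i
  proof (rule payoff_expectation)
    have "?a \<omega> i - \<theta> = (1 - \<beta> i) * fst \<omega> i + \<beta> i * snd \<omega>" for \<omega>
      by (simp add: algebra_simps)
    then show "has_bochner_integral ?P (\<lambda>\<omega>. (?a \<omega> i - \<theta>)\<^sup>2)
        ((1 - \<beta> i)\<^sup>2 * (1 / \<tau>x) + (\<beta> i)\<^sup>2 * (1 / \<tau>y))"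
      using centred_second_moment[OF centred_pair[OF centred_scale[OF centred_PiM_component[OF c]] cy]]
      by (simp add: private_noise_def)
  next
    fix j assume "j \<noteq> i"
    have eq: "?a \<omega> i - ?a \<omega> j = (1 - \<beta> i) * fst \<omega> i + - (1 - \<beta> j) * fst \<omega> j + (\<beta> i - \<beta> j) * snd \<omega>" for \<omega>
      by (simp add: algebra_simps)
    show "has_bochner_integral ?P (\<lambda>\<omega>. (?a \<omega> i - ?a \<omega> j)\<^sup>2)
        (((1 - \<beta> i)\<^sup>2 + (- (1 - \<beta> j))\<^sup>2) * (1 / \<tau>x) + (\<beta> i - \<beta> j)\<^sup>2 * (1 / \<tau>y))"
      unfolding eq private_noise_def
      by (intro centred_second_moment centred_pair[OF centred_PiM_two_components[OF c] cy])
         (use \<open>j \<noteq> i\<close> in simp)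
  qed
  from has_bochner_integral_integral_eq[OF this] show ?thesis
    unfolding welfare_def equilibrium_eq[OF G \<tau> \<gamma>] \<beta>[symmetric] case_prod_beta
    by (simp only: sum_off_diagonal(1)[OF G] power2_minus)
qed

text \<open>Every squared gap is split into the two agents' own error variances and a covariance.
  Summing the variances by the agent observed brings in the in-degrees; then the difference of
  welfares can be computed agent by agent.\<close>

lemma welfare_effect_eq:
  assumes G: "interaction_network G" and \<tau>: "0 < \<tau>x" "0 < \<tau>y" and \<gamma>: "\<gamma> = \<tau>x / (\<tau>x + \<tau>y)"
  shows "welfare_effect \<theta> \<tau>x \<tau>y G = \<tau>y / (\<tau>x * (\<tau>x + \<tau>y)) *
    (\<Sum>i\<in>UNIV. katz_bonacich \<gamma> G $ i *
       ((1 - in_degree G i) * katz_bonacich \<gamma> G $ i + 2 * in_degree G i))"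
proof -
  define c where "c i = katz_bonacich \<gamma> G $ i" for i
  define \<beta> where "\<beta> i = (1 - \<gamma>) * c i" for i
  let ?o = "out_degree G" and ?d = "in_degree G"
  have \<gamma>01: "0 < \<gamma>" "\<gamma> < 1"
    using \<tau> \<gamma> by auto
  have out: "?o i = (\<Sum>j\<in>UNIV. G $ i $ j)" for i
    by (rule out_degree_eq) fact
  \<comment> \<open>Exchanging the order of summation collects the weights that all others put on
    \<open>j\<close>: here in-degrees replace out-degrees.\<close>
  have swap: "(\<Sum>i\<in>UNIV. \<Sum>j\<in>UNIV. G $ i $ j * f j) = (\<Sum>i\<in>UNIV. ?d i * f i)" for f
    by (subst sum.swap) (simp add: in_degree_eq[OF G] sum_distrib_right)
  have c: "(\<Sum>j\<in>UNIV. G $ i $ j * c j) = (c i - 1) / \<gamma>" for i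
    using katz_bonacich_fixed_point[OF G, of \<gamma> i] \<gamma>01 by (simp add: c_def)
  \<comment> \<open>In terms of \<open>\<gamma>\<close> and \<open>p\<close> all coefficients below are polynomials.\<close>
  define p where "p = 1 / (\<gamma> * (1 - \<gamma>) * (\<tau>x + \<tau>y))"
  have nz: "\<tau>x \<noteq> 0" "\<tau>y \<noteq> 0" "\<tau>x + \<tau>y \<noteq> 0"
    using \<tau> by auto
  then have "1 - \<gamma> = \<tau>y / (\<tau>x + \<tau>y)"
    by (simp add: \<gamma> diff_divide_eq_iff)
  then have \<tau>x: "1 / \<tau>x = (1 - \<gamma>) * p" and \<tau>y: "1 / \<tau>y = \<gamma> * p"
    and K: "\<tau>y / (\<tau>x * (\<tau>x + \<tau>y)) = (1 - \<gamma>)\<^sup>2 * p"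
    using nz unfolding p_def by (simp_all add: \<gamma> power2_eq_square)
  \<comment> \<open>The variance of the equilibrium action of \<open>j\<close> around the
    state.\<close>
  define g where "g j = ((1 - \<gamma>) * (1 - \<beta> j)\<^sup>2 + \<gamma> * (\<beta> j)\<^sup>2) * p" for j
  \<comment> \<open>Two agents' errors covary only through the public noise, with covariance
    \<open>\<beta> i * \<beta> j / \<tau>y\<close>. This is the one mixed term, and its sum over
    \<open>j\<close> is known from the fixed-point equation \<open>c\<close>.\<close>
  have inner: "(\<Sum>j\<in>UNIV. G $ i $ j *
        (((1 - \<beta> i)\<^sup>2 + (1 - \<beta> j)\<^sup>2) * ((1 - \<gamma>) * p) + (\<beta> i - \<beta> j)\<^sup>2 * (\<gamma> * p)))
      = ?o i * g i + (\<Sum>j\<in>UNIV. G $ i $ j * g j) - 2 * (1 - \<gamma>)\<^sup>2 * p * c i * (c i - 1)" for i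
  proof -
    have "(\<Sum>j\<in>UNIV. G $ i $ j *
        (((1 - \<beta> i)\<^sup>2 + (1 - \<beta> j)\<^sup>2) * ((1 - \<gamma>) * p) + (\<beta> i - \<beta> j)\<^sup>2 * (\<gamma> * p)))
      = (\<Sum>j\<in>UNIV. G $ i $ j * g i + G $ i $ j * g j
          - 2 * (1 - \<gamma>)\<^sup>2 * p * c i * \<gamma> * (G $ i $ j * c j))"
    proof (rule sum.cong)
      fix j
      show "G $ i $ j * (((1 - \<beta> i)\<^sup>2 + (1 - \<beta> j)\<^sup>2) * ((1 - \<gamma>) * p) + (\<beta> i - \<beta> j)\<^sup>2 * (\<gamma> * p))
        = G $ i $ j * g i + G $ i $ j * g j - 2 * (1 - \<gamma>)\<^sup>2 * p * c i * \<gamma> * (G $ i $ j * c j)"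
        unfolding g_def \<beta>_def by algebra
    qed simp
    also have "\<dots> = ?o i * g i + (\<Sum>j\<in>UNIV. G $ i $ j * g j)
        - 2 * (1 - \<gamma>)\<^sup>2 * p * c i * \<gamma> * ((c i - 1) / \<gamma>)"
      unfolding c[symmetric] out
      by (simp only: sum.distrib sum_subtractf sum_distrib_left sum_distrib_right)
    finally show ?thesis
      using \<gamma>01 by simp
  qed
  \<comment> \<open>The terms \<open>(1 - ?o i) * g i\<close> and \<open>?o i * g i\<close> add up
    to \<open>g i\<close>, so out-degrees disappear.\<close>
  have "welfare \<theta> \<tau>x \<tau>y G = (\<Sum>i\<in>UNIV. - g i + 2 * (1 - \<gamma>)\<^sup>2 * p * c i * (c i - 1)
      - (\<Sum>j\<in>UNIV. G $ i $ j * g j))"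
    unfolding welfare_eq[OF G \<tau> \<gamma> \<beta>_def[unfolded c_def]] \<tau>x \<tau>y inner
    by (intro sum.cong) (auto simp: g_def algebra_simps)
  also have "\<dots> = (\<Sum>i\<in>UNIV. - g i + 2 * (1 - \<gamma>)\<^sup>2 * p * c i * (c i - 1) - ?d i * g i)"
    by (simp only: sum_subtractf swap)
  finally have W: "welfare \<theta> \<tau>x \<tau>y G = \<dots>" .
  \<comment> \<open>Total out-degree equals total in-degree, which lets the private benchmark be
    written with in-degrees as well.\<close>
  have "(\<Sum>i\<in>UNIV. ?o i) = (\<Sum>i\<in>UNIV. ?d i)"
    using swap[of "\<lambda>_. 1"] by (simp add: out)
  then have W0: "welfare_private \<theta> \<tau>x G = - (\<Sum>i\<in>UNIV. (1 + ?d i) * ((1 - \<gamma>) * p))"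
    unfolding welfare_private_eq[OF G \<tau>(1)] \<tau>x[symmetric]
    by (simp add: sum_divide_distrib[symmetric] sum.distrib)
  have "- g i + 2 * (1 - \<gamma>)\<^sup>2 * p * c i * (c i - 1) - ?d i * g i + (1 + ?d i) * ((1 - \<gamma>) * p)
      = (1 - \<gamma>)\<^sup>2 * p * (c i * ((1 - ?d i) * c i + 2 * ?d i))" for i
    unfolding g_def \<beta>_def by algebra
  then show ?thesis
    unfolding welfare_effect_def W W0 c_def[symmetric] K diff_minus_eq_add sum_distrib_left
    by (simp only: sum.distrib[symmetric])
qed

theorem proposition3:
  fixes G :: "real ^ 'n ^ 'n::finite" and \<theta> \<tau>x \<tau>y \<gamma> :: real
  assumes "CARD('n) \<ge> 2"
    and "interaction_network G"
    and "\<tau>x > 0" and "\<tau>y > 0"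
    and "\<gamma> = \<tau>x / (\<tau>x + \<tau>y)"
  shows "welfare_effect \<theta> \<tau>x \<tau>y G < 0 \<longleftrightarrow>
    (\<Sum>i\<in>UNIV. katz_bonacich \<gamma> G $ i *
       ((1 - in_degree G i) * katz_bonacich \<gamma> G $ i + 2 * in_degree G i)) < 0"
proof -
  have "0 < \<tau>y / (\<tau>x * (\<tau>x + \<tau>y))"
    using assms by simp
  then show ?thesis
    unfolding welfare_effect_eq[OF assms(2-5)] by (rule mult_less_cancel_left_pos[where b = 0, simplified])
qed

end
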